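(* Let $R \in (1,\infty]$ and let $K : D(0,R) \to \mathbb{C}$. The following are equivalent: (1) $K$ is multiplicative on $D(0,R)$, is continuous on $S^1 \subset D(0,R)$, sends $\widetilde{I} := (0,R)$ to $\mathbb{R}$, and is Lebesgue measurable on some nondegenerate subinterval $I \subset \widetilde{I}$ which contains $1$. (2) Either $K \equiv 0$ or $K \equiv 1$ on $D(0,R)$, or there exist $\alpha \in \mathbb{R}$ and $\beta \in \mathbb{Z}$ such that $K \equiv \Psi_{\alpha,\beta}$ on $D(0,R)$. Moreover, the maps $\{\Psi_{\alpha,\beta} : \alpha \in \mathbb{R}, \beta \in \mathbb{Z}\} \cup \{K \equiv 1\}$ are linearly independent as functions on $D(0,r)$ for any $0 < r \leq \infty$.
   Context: $D(a,R)$ denotes the complex disc centered at $a$ of radius $R$ (with $D(0,\infty) = \mathbb{C}$), taken to be open, and $S^1 := \{z \in \mathbb{C} : |z| = 1\}$. "$K$ is multiplicative on $D(0,R)$" means $K(zw) = K(z)K(w)$ whenever $z,w,zw \in D(0,R)$. "Continuous on $S^1$" means that the restriction $K|_{S^1}$ is continuous. For $\alpha \in \mathbb{R}$, $\beta \in \mathbb{Z}$, $\Psi_{\alpha,\beta}:\mathbb{C}\to\mathbb{C}$ is defined by $\Psi_{\alpha,\beta}(re^{i\theta}) := r^\alpha e^{i\beta\theta}$ for $r>0$, $\theta \in (-\pi,\pi]$, and $\Psi_{\alpha,\beta}(0) := 0$. Linear independence is over $\mathbb{C}$. *)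

theory Defs
  imports "HOL-Analysis.Analysis" "HOL-Library.Function_Algebras"
begin

definition multiplicative_on :: "complex set \<Rightarrow> (complex \<Rightarrow> complex) \<Rightarrow> bool" where
  "multiplicative_on D K \<longleftrightarrow> (\<forall>z\<in>D. \<forall>w\<in>D. z * w \<in> D \<longrightarrow> K (z * w) = K z * K w)"

text \<open>The branch of the argument is the one with values in \<open>(-\<pi>, \<pi>]\<close>.\<close>

definition Psi :: "real \<Rightarrow> int \<Rightarrow> complex \<Rightarrow> complex" where
  "Psi \<alpha> \<beta> z = (if z = 0 then 0
     else of_real (cmod z powr \<alpha>) * exp (\<i> * of_int \<beta> * of_real (Arg z)))"

lemma Psi_polar:
  assumes "r > 0" "\<theta> \<in> {-pi<..pi}"
  shows "Psi \<alpha> \<beta> (of_real r * exp (\<i> * of_real \<theta>))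
       = of_real (r powr \<alpha>) * exp (\<i> * of_int \<beta> * of_real \<theta>)"
proof -
  have "Arg (of_real r * exp (\<i> * of_real \<theta>)) = \<theta>"
    using assms Arg_unique by auto
  then show ?thesis
    using assms by (simp add: Psi_def norm_mult)
qed

lemma Psi_eq_iff: "Psi \<alpha> \<beta> = Psi \<alpha>' \<beta>' \<longleftrightarrow> \<alpha> = \<alpha>' \<and> \<beta> = \<beta>'"
proof
  assume eq: "Psi \<alpha> \<beta> = Psi \<alpha>' \<beta>'"
  have "Psi a b 2 = of_real (2 powr a)" for a b
    using Psi_polar[of 2 0 a b] by simp
  then have "of_real (2 powr \<alpha>) = (of_real (2 powr \<alpha>') :: complex)"
    using eq by metis
  then have "2 powr \<alpha> = (2::real) powr \<alpha>'"
    using of_real_eq_iff by blast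
  then have \<alpha>: "\<alpha> = \<alpha>'" using powr_inj[of 2] by simp
  have "\<beta> = \<beta>'"
  proof (rule ccontr)
    assume ne: "\<beta> \<noteq> \<beta>'"
    define d where "d = real_of_int (\<beta> - \<beta>')"
    have d: "\<bar>d\<bar> \<ge> 1" "d \<noteq> 0" using ne unfolding d_def by linarith+
    define t where "t = 1 / d"
    have "\<bar>t\<bar> \<le> 1" using d by (simp add: t_def divide_simps)
    then have t: "t \<in> {-pi<..pi}" using pi_gt3 by auto
    have "exp (\<i> * of_int \<beta> * of_real t) = exp (\<i> * of_int \<beta>' * of_real t)"
      using Psi_polar[of 1 t \<alpha> \<beta>] Psi_polar[of 1 t \<alpha>' \<beta>'] t eq by simp
    then have "exp (\<i> * of_int \<beta> * of_real t - \<i> * of_int \<beta>' * of_real t) = 1"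
      by (simp add: exp_diff)
    moreover have "\<i> * of_int \<beta> * of_real t - \<i> * of_int \<beta>' * of_real t
        = \<i> * complex_of_real (d * t)"
      by (simp add: d_def algebra_simps)
    ultimately have "exp (\<i> * complex_of_real 1) = 1" using d by (simp add: t_def)
    then have "cis 1 = 1" by (simp add: cis_conv_exp)
    then have "sin (1::real) = 0" by (metis cis.sel(2) one_complex.sel(2))
    then show False using sin_gt_zero[of 1] pi_gt3 by simp
  qed
  with \<alpha> show "\<alpha> = \<alpha>' \<and> \<beta> = \<beta>'" by simp
qed simp

abbreviation cscale :: "complex \<Rightarrow> ('a \<Rightarrow> complex) \<Rightarrow> 'a \<Rightarrow> complex" where
  "cscale \<equiv> (\<lambda>c f z. c * f z)"

lemma vector_space_cscale: "vector_space cscale"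
  by unfold_locales (auto simp: fun_eq_iff algebra_simps)

text \<open>The functions \<open>D \<rightarrow> \<complex>\<close> are identified with the functions vanishing outside \<open>D\<close>.
  Injectivity demands that distinct members of \<open>F\<close> stay distinct on \<open>D\<close>.\<close>

definition restrict0 :: "'a set \<Rightarrow> ('a \<Rightarrow> complex) \<Rightarrow> 'a \<Rightarrow> complex" where
  "restrict0 D f = (\<lambda>z. if z \<in> D then f z else 0)"

definition lin_independent_on :: "'a set \<Rightarrow> ('a \<Rightarrow> complex) set \<Rightarrow> bool" where
  "lin_independent_on D F \<longleftrightarrow>
     inj_on (restrict0 D) F \<and> \<not> module.dependent cscale (restrict0 D ` F)"

end

theory Submission imports Defs begin

text \<open>The point \<open>0\<close> annihilates and \<open>1\<close> is neutral, so a multiplicative \<open>K\<close> is constantly \<open>1\<close> if \<open>K 0 \<noteq> 0\<close>,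
  and constantly \<open>0\<close> if \<open>K 1 = 0\<close>. In the remaining case \<open>K 0 = 0\<close> and \<open>K 1 = 1\<close>. As \<open>R > 1\<close>, the disc contains the
  unit circle, and polar coordinates split \<open>K\<close> into its restrictions to the radius \<open>(0, R)\<close> and to the
  circle.

  On the radius, \<open>K\<close> is real and in fact positive, and \<open>t \<mapsto> ln (K (exp t))\<close> is additive on the half-line where
  \<open>exp t < R\<close>. Measurability on an interval bounds \<open>K\<close> on one side of \<open>1\<close> by Steinhaus' argument
  (\<open>measurable_multiplicative_locally_bounded\<close>). An additive function bounded on one side of \<open>0\<close> is linear
  (\<open>additive_bounded_near_0_linear\<close>), so \<open>K\<close> is a power there (\<open>measurable_multiplicative_powr\<close>).
  On the circle, \<open>t \<mapsto> K (cis t)\<close> is a continuous character of \<open>\<real>\<close>, hence an exponential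
  (\<open>continuous_character_exponential\<close>), and periodicity makes the exponent \<open>\<i> \<beta>\<close> with an integer \<open>\<beta>\<close>.

  Conversely, \<open>Psi \<alpha> \<beta> z = \<bar>z\<bar> powr \<alpha> * sgn z powi \<beta>\<close> shows that these functions have all the properties
  required. Their linear independence is Dedekind's theorem on distinct characters
  (\<open>characters_independent\<close>), applied to a small disc as a multiplicative semigroup.\<close>

section \<open>Independence of characters\<close>

text \<open>Dedekind's argument, carried out on a subset \<open>M\<close> closed under multiplication. Evaluate a vanishing
  combination at \<open>w x\<close>, and subtract \<open>g w\<close> times its value at \<open>x\<close>: the term of \<open>g\<close> drops out, and the
  coefficient of every other \<open>h\<close> is multiplied by \<open>h w - g w\<close>, which is nonzero for a suitable \<open>w\<close>.
  So a shorter combination vanishes, and induction applies.\<close>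

lemma characters_independent:
  fixes S :: "('a::semigroup_mult \<Rightarrow> 'b::field) set"
  assumes "finite S"
    and mult: "\<And>f x y. f \<in> S \<Longrightarrow> x \<in> M \<Longrightarrow> y \<in> M \<Longrightarrow> f (x * y) = f x * f y"
    and closed: "\<And>x y. x \<in> M \<Longrightarrow> y \<in> M \<Longrightarrow> x * y \<in> M"
    and nonzero: "\<And>f. f \<in> S \<Longrightarrow> \<exists>x\<in>M. f x \<noteq> 0"
    and distinct: "\<And>f g. f \<in> S \<Longrightarrow> g \<in> S \<Longrightarrow> f \<noteq> g \<Longrightarrow> \<exists>x\<in>M. f x \<noteq> g x"
    and vanish: "\<And>x. x \<in> M \<Longrightarrow> (\<Sum>f\<in>S. c f * f x) = 0"
    and "f \<in> S"
  shows "c f = 0"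
  using assms(1,2,4-)
proof (induction S arbitrary: c f rule: finite_induct)
  case empty
  then show ?case by simp
next
  case (insert g S)
  have zero: "c h = 0" if h: "h \<in> S" for h
  proof -
    have "h \<noteq> g" using h insert.hyps by auto
    then obtain w where w: "w \<in> M" "h w \<noteq> g w"
      using insert.prems(3)[of h g] h by blast
    have "(\<Sum>k\<in>S. (c k * (k w - g w)) * k x) = 0" if x: "x \<in> M" for x
    proof -
      have "c g * (g w * g x) + (\<Sum>k\<in>S. c k * (k w * k x)) = 0"
        using insert.prems(4)[OF closed[OF w(1) x]] insert.hyps insert.prems(1)[OF _ w(1) x] by simp
      moreover have "c g * (g w * g x) + (\<Sum>k\<in>S. c k * (g w * k x)) = 0"
        using arg_cong[OF insert.prems(4)[OF x], of "\<lambda>t. g w * t"] insert.hyps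
        by (simp add: distrib_left sum_distrib_left mult.left_commute)
      ultimately have "(\<Sum>k\<in>S. c k * (k w * k x)) - (\<Sum>k\<in>S. c k * (g w * k x)) = 0"
        by (simp add: add_eq_0_iff)
      then show ?thesis
        by (simp add: sum_subtractf left_diff_distrib right_diff_distrib mult.assoc)
    qed
    then have "c h * (h w - g w) = 0"
      using insert.prems(1-3) h
      by (intro insert.IH[where c = "\<lambda>k. c k * (k w - g w)" and f = h]) auto
    then show ?thesis using w(2) by simp
  qed
  have "c g * g x = 0" if "x \<in> M" for x
    using insert.prems(4)[OF that] zero insert.hyps by simp
  then have "c g = 0"
    using insert.prems(2)[of g] by auto
  then show ?case
    using insert.prems(5) zero by auto
qed

section \<open>The functions \<open>Psi\<close>\<close>

text \<open>In this form the function depends only on the modulus and the direction of its argument,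
  not on the branch chosen for the argument, so multiplicativity can be read off.\<close>

lemma Psi_eq_sgn_power:
  assumes "z \<noteq> 0"
  shows "Psi \<alpha> \<beta> z = of_real (cmod z powr \<alpha>) * sgn z powi \<beta>"
proof -
  have "exp (\<i> * of_int \<beta> * of_real (Arg z)) = cis (of_int \<beta> * Arg z)"
    by (simp add: cis_conv_exp mult.assoc)
  also have "\<dots> = sgn z powi \<beta>"
    by (simp add: cis_Arg[OF assms] flip: cis_power_int)
  finally have "exp (\<i> * of_int \<beta> * of_real (Arg z)) = sgn z powi \<beta>" .
  then show ?thesis using assms by (simp add: Psi_def)
qed

lemma Psi_0 [simp]: "Psi \<alpha> \<beta> 0 = 0"
  by (simp add: Psi_def)

lemma Psi_nonzero: "z \<noteq> 0 \<Longrightarrow> Psi \<alpha> \<beta> z \<noteq> 0"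
  by (simp add: Psi_def)

lemma Psi_mult: "Psi \<alpha> \<beta> (z * w) = Psi \<alpha> \<beta> z * Psi \<alpha> \<beta> w"
proof (cases "z = 0 \<or> w = 0")
  case False
  then show ?thesis
    by (simp add: Psi_eq_sgn_power norm_mult powr_mult sgn_mult power_int_mult_distrib)
qed auto

lemma Psi_of_real:
  assumes "x > 0"
  shows "Psi \<alpha> \<beta> (of_real x) = of_real (x powr \<alpha>)"
  using assms Psi_polar[of x 0 \<alpha> \<beta>] by simp

lemma Psi_continuous_on_circle: "continuous_on (sphere 0 1) (Psi \<alpha> \<beta>)"
proof -
  have "Psi \<alpha> \<beta> z = z powi \<beta>" if "z \<in> sphere 0 1" for z
    using that by (subst Psi_eq_sgn_power) (auto simp: sgn_eq)
  moreover have "continuous_on (sphere 0 1) (\<lambda>z::complex. z powi \<beta>)"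
    by (intro continuous_intros) auto
  ultimately show ?thesis
    by (rule continuous_on_cong[OF refl, THEN iffD2])
qed

text \<open>A multiplicative function without zeros except \<open>0\<close> extends uniquely from a disc about \<open>0\<close>: the value at \<open>z\<close> is the
  quotient of the values at \<open>s z\<close> and \<open>s\<close>, both of which lie in the disc for small \<open>s > 0\<close>.\<close>

lemma Psi_determined_near_0:
  assumes "\<rho> > 0" and eq: "\<And>z. z \<in> ball 0 \<rho> \<Longrightarrow> Psi \<alpha> \<beta> z = Psi \<alpha>' \<beta>' z"
  shows "Psi \<alpha> \<beta> = Psi \<alpha>' \<beta>'"
proof
  fix z :: complex
  define s where "s = \<rho> / (2 * (1 + cmod z))"
  have "s * (1 + cmod z) = \<rho> / 2"
    using add_pos_nonneg[of 1 "cmod z"] by (simp add: s_def divide_simps)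
  then have "s + s * cmod z = \<rho> / 2"
    by (simp only: distrib_left mult_1_right)
  moreover have s0: "s > 0"
    unfolding s_def using \<open>\<rho> > 0\<close> by (intro divide_pos_pos mult_pos_pos add_pos_nonneg) auto
  moreover have "s * cmod z \<ge> 0"
    using s0 by simp
  ultimately have s: "s > 0" "s < \<rho>" "s * cmod z < \<rho>"
    using \<open>\<rho> > 0\<close> by linarith+
  have "Psi \<alpha> \<beta> (of_real s) * Psi \<alpha> \<beta> z = Psi \<alpha>' \<beta>' (of_real s) * Psi \<alpha>' \<beta>' z"
    using eq[of "of_real s * z"] s by (simp add: norm_mult Psi_mult)
  moreover have "Psi \<alpha> \<beta> (of_real s) = Psi \<alpha>' \<beta>' (of_real s)"
    using eq[of "of_real s"] s by simp
  moreover have "Psi \<alpha>' \<beta>' (of_real s) \<noteq> 0"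
    using s by (intro Psi_nonzero) simp
  ultimately show "Psi \<alpha> \<beta> z = Psi \<alpha>' \<beta>' z" by simp
qed

lemma sum_fun_eval: "(\<Sum>i\<in>S. f i) x = (\<Sum>i\<in>S. f i x)"
  for f :: "'i \<Rightarrow> 'a \<Rightarrow> 'b::comm_monoid_add"
  by (induction S rule: infinite_finite_induct) auto

text \<open>The members of the family are distinct characters of a small disc that is closed under
  multiplication; for this its radius must not exceed \<open>1\<close>. The point \<open>0\<close> has to
  be kept in the semigroup, as it alone tells the constant \<open>1\<close> apart from \<open>Psi 0 0\<close>.\<close>

lemma Psi_family_independent:
  assumes "(0::ereal) < r"
  shows "lin_independent_on (eball 0 r) ({Psi \<alpha> \<beta> | \<alpha> \<beta>. True} \<union> {\<lambda>z. 1})"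
    (is "lin_independent_on ?D ?F")
proof -
  obtain \<rho> :: real where \<rho>: "0 < \<rho>" "\<rho> \<le> 1" "ereal \<rho> \<le> r"
  proof (cases r)
    case (real x)
    then show ?thesis using that[of "min x 1"] assms by auto
  qed (use assms that[of 1] in auto)
  define M :: "complex set" where "M = ball 0 \<rho>"
  have "0 \<in> M" using \<rho> by (simp add: M_def)
  have sub: "z \<in> ?D" if "z \<in> M" for z
    using that ball_eball_mono[OF \<rho>(3), of "0::complex"] unfolding M_def by blast
  have closed: "z * w \<in> M" if "z \<in> M" "w \<in> M" for z w
  proof -
    have "cmod z * cmod w \<le> cmod z * 1"
      using that \<rho> by (intro mult_left_mono) (auto simp: M_def)
    then show ?thesis using that by (simp add: M_def norm_mult)
  qed
  have mult: "f (z * w) = f z * f w" if "f \<in> ?F" for f z w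
    using that by (auto simp: Psi_mult)
  have nonzero: "\<exists>z\<in>M. f z \<noteq> 0" if "f \<in> ?F" for f
    using that \<rho> by (intro bexI[of _ "of_real (\<rho>/2)"]) (auto simp: M_def Psi_nonzero)
  have distinct: "\<exists>z\<in>M. f z \<noteq> g z" if "f \<in> ?F" "g \<in> ?F" "f \<noteq> g" for f g
  proof (rule ccontr)
    assume *: "\<not> (\<exists>z\<in>M. f z \<noteq> g z)"
    then have "f 0 = g 0" using \<open>0 \<in> M\<close> by auto
    with that obtain \<alpha> \<beta> \<alpha>' \<beta>' where "f = Psi \<alpha> \<beta>" "g = Psi \<alpha>' \<beta>'"
      by auto
    with * Psi_determined_near_0[OF \<rho>(1)] that(3) show False
      unfolding M_def by metis
  qed
  have "inj_on (restrict0 ?D) ?F"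
  proof (rule inj_onI, rule ccontr)
    fix f g assume "f \<in> ?F" "g \<in> ?F" "f \<noteq> g" and eq: "restrict0 ?D f = restrict0 ?D g"
    with distinct obtain z where "z \<in> M" "f z \<noteq> g z" by blast
    with sub[of z] fun_cong[OF eq, of z] show False by (simp add: restrict0_def)
  qed
  moreover have "\<not> module.dependent cscale (restrict0 ?D ` ?F)"
  proof -
    interpret vector_space cscale
      by (rule vector_space_cscale)
    show ?thesis
      unfolding independent_explicit_module
    proof (intro allI impI)
      fix S u v
      assume S: "finite S" "S \<subseteq> restrict0 ?D ` ?F" "(\<Sum>f\<in>S. (\<lambda>z. u f * f z)) = 0" "v \<in> S"
      have agree: "\<exists>g\<in>?F. h = restrict0 ?D g \<and> (\<forall>z\<in>M. h z = g z)" if h: "h \<in> S" for h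
      proof -
        obtain g where "g \<in> ?F" "h = restrict0 ?D g"
          using h S(2) by blast
        then show ?thesis
          using sub by (intro bexI[of _ g]) (simp_all add: restrict0_def)
      qed
      show "u v = 0"
      proof (rule characters_independent[OF S(1), where M = M and c = u and f = v])
        fix f assume f: "f \<in> S"
        obtain f' where f': "f' \<in> ?F" "f = restrict0 ?D f'" "\<forall>z\<in>M. f z = f' z"
          using agree[OF f] by blast
        show "f (x * y) = f x * f y" if "x \<in> M" "y \<in> M" for x y
          using f'(3) that closed[OF that] mult[OF f'(1), of x y] by simp
        show "\<exists>x\<in>M. f x \<noteq> 0"
          using f'(3) nonzero[OF f'(1)] by simp
        fix g assume g: "g \<in> S" "f \<noteq> g"
        obtain g' where g': "g' \<in> ?F" "g = restrict0 ?D g'" "\<forall>z\<in>M. g z = g' z"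
          using agree[OF g(1)] by blast
        have "f' \<noteq> g'" using g(2) f'(2) g'(2) by blast
        with distinct[OF f'(1) g'(1)] show "\<exists>x\<in>M. f x \<noteq> g x"
          using f'(3) g'(3) by simp
      next
        show "(\<Sum>f\<in>S. u f * f z) = 0" for z
          using fun_cong[OF S(3), of z] by (simp add: sum_fun_eval)
      qed (use closed S(4) in auto)
    qed
  qed
  ultimately show ?thesis
    by (simp add: lin_independent_on_def)
qed

section \<open>Measurable multiplicative functions on an interval\<close>

text \<open>The deviation of \<open>G\<close> from a linear function is additive and vanishes at the rational numbers. Shifting by
  rationals, its bound near \<open>0\<close> becomes a bound everywhere; as \<open>E (m t) = m E t\<close>, a bounded
  additive function is zero. A single grid \<open>\<int> / n\<close> of mesh below \<open>\<delta>\<close> provides the shifts.\<close>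

lemma additive_bounded_near_0_linear:
  fixes G :: "real \<Rightarrow> real"
  assumes add: "\<And>s t. G (s + t) = G s + G t"
    and "\<delta> > 0" and bound: "\<And>t. 0 \<le> t \<Longrightarrow> t \<le> \<delta> \<Longrightarrow> \<bar>G t\<bar> \<le> B"
  shows "G t = G 1 * t"
proof -
  define E where "E t = G t - G 1 * t" for t
  have E_add: "E (s + t) = E s + E t" for s t
    by (simp add: E_def add algebra_simps)
  have E_0: "E 0 = 0"
    using E_add[of 0 0] by simp
  have E_minus: "E (- t) = - E t" for t
    using E_add[of t "-t"] E_0 by simp
  have E_nat: "E (real n * t) = real n * E t" for n t
    by (induction n) (simp_all add: E_0 E_add algebra_simps)
  have E_int: "E (of_int k * t) = of_int k * E t" for k t
  proof (cases k)
    case (nonneg n)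
    then show ?thesis by (simp add: E_nat)
  next
    case (neg n)
    have "E (of_int k * t) = - E (real (Suc n) * t)"
      by (simp only: neg E_minus[symmetric] of_int_minus of_int_of_nat_eq mult_minus_left)
    also have "\<dots> = of_int k * E t"
      by (simp only: neg E_nat of_int_minus of_int_of_nat_eq mult_minus_left)
    finally show ?thesis .
  qed
  have E_1: "E 1 = 0"
    by (simp add: E_def)
  obtain n :: nat where n: "n > 0" "inverse (real n) < \<delta>"
    using reals_Archimedean[OF \<open>\<delta> > 0\<close>] by blast
  have E_inv: "E (inverse (real n)) = 0"
    using E_nat[of n "inverse (real n)"] n E_1 by simp
  have E_bound: "\<bar>E t\<bar> \<le> B + \<bar>G 1\<bar> * \<delta>" for t
  proof -
    define k where "k = \<lfloor>t * real n\<rfloor>"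
    define s where "s = t - of_int k * inverse (real n)"
    have "of_int k \<le> t * real n" "t * real n < of_int k + 1"
      unfolding k_def by linarith+
    then have "of_int k / real n \<le> t" "t < (of_int k + 1) / real n"
      using n by (simp_all add: pos_divide_le_eq pos_less_divide_eq)
    then have s: "0 \<le> s" "s \<le> inverse (real n)"
      by (simp_all add: s_def distrib_right divide_inverse)
    have "E t = E s"
      using E_add[of s "of_int k * inverse (real n)"] E_int E_inv by (simp add: s_def)
    also have "\<bar>\<dots>\<bar> \<le> \<bar>G s\<bar> + \<bar>G 1\<bar> * \<bar>s\<bar>"
      unfolding E_def by (metis abs_mult abs_triangle_ineq4)
    also have "\<dots> \<le> B + \<bar>G 1\<bar> * \<delta>"
      using s n by (intro add_mono mult_left_mono bound) auto
    finally show ?thesis .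
  qed
  have "E t = 0"
  proof (rule ccontr)
    assume "E t \<noteq> 0"
    then obtain m :: nat where "B + \<bar>G 1\<bar> * \<delta> < real m * \<bar>E t\<bar>"
      using reals_Archimedean3[of "\<bar>E t\<bar>"] by auto
    with E_bound[of "real m * t"] show False
      by (simp add: E_nat abs_mult)
  qed
  then show ?thesis by (simp add: E_def)
qed

text \<open>Passing to the odd extension of \<open>g\<close> turns Cauchy's equation on a half-line into Cauchy's equation on \<open>\<real>\<close>.\<close>

lemma additive_on_halfline_extends:
  fixes g :: "real \<Rightarrow> real"
  assumes add: "\<And>s t. s \<le> 0 \<Longrightarrow> t \<le> 0 \<Longrightarrow> g (s + t) = g s + g t"
  defines "G \<equiv> \<lambda>t. g (min t 0) - g (min (- t) 0)"
  shows "G (s + t) = G s + G t"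
proof -
  have g0: "g 0 = 0" using add[of 0 0] by simp
  consider "s \<le> 0" "t \<le> 0" | "s \<ge> 0" "t \<ge> 0" | "s \<le> 0" "t \<ge> 0" "s + t \<le> 0" | "s \<le> 0" "t \<ge> 0" "s + t \<ge> 0"
    | "s \<ge> 0" "t \<le> 0" "s + t \<le> 0" | "s \<ge> 0" "t \<le> 0" "s + t \<ge> 0" by linarith
  then show ?thesis
    using add[of s t] add[of "-s" "-t"] add[of "s + t" "-t"] add[of s "-(s+t)"]
      add[of "s + t" "-s"] add[of t "-(s+t)"] g0
    by cases (auto simp: G_def min_def)
qed

text \<open>The multiplicative form of Steinhaus' argument. Some set \<open>E = {x. 1 / N \<le> k x \<le> N}\<close> fills more than three
  quarters of \<open>[a, b]\<close>. For \<open>l\<close> slightly above \<open>1\<close>, both \<open>E\<close> and \<open>l E\<close> lie in an interval of length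
  \<open>5/4 (b - a)\<close>, which is too short to contain them disjointly. At a common point, \<open>k l\<close> is a quotient of two
  values of \<open>k\<close> in \<open>[1 / N, N]\<close>. Multiplicativity is demanded only for the products that occur, so that the
  lemma applies to functions that are multiplicative on a bounded interval.\<close>

lemma measurable_multiplicative_locally_bounded:
  fixes k :: "real \<Rightarrow> real"
  assumes "0 < a" "a < b"
    and meas: "k \<in> borel_measurable (lebesgue_on {a..b})"
    and pos: "\<And>x. x \<in> {a..b} \<Longrightarrow> k x > 0"
  obtains q M where "q > 1" "M > 0"
    "\<And>l. 1 \<le> l \<Longrightarrow> l \<le> q \<Longrightarrow> (\<And>x. x \<in> {a..b} \<Longrightarrow> l * x \<in> {a..b} \<Longrightarrow> k (l * x) = k l * k x)
      \<Longrightarrow> inverse M \<le> k l \<and> k l \<le> M"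
proof -
  define E where "E n = {x \<in> {a..b}. k x \<in> {inverse (real (Suc n))..real (Suc n)}}" for n
  have E_sets: "E n \<in> sets lebesgue" for n
  proof -
    have "{a..b} \<in> sets lebesgue" by simp
    then have "\<forall>T. T \<in> sets borel \<longrightarrow> {x \<in> {a..b}. k x \<in> T} \<in> sets lebesgue"
      using borel_measurable_lebesgue_on_preimage_borel[of "{a..b}" k] meas by blast
    moreover have "{inverse (real (Suc n))..real (Suc n)} \<in> sets borel"
      by measurable
    ultimately show ?thesis
      unfolding E_def by blast
  qed
  have E_lm: "E n \<in> lmeasurable" for n
    by (rule bounded_set_imp_lmeasurable[OF bounded_subset[of "{a..b}"] E_sets]) (auto simp: E_def)
  have "(\<Union>n. E n) = {a..b}"
  proof (intro equalityI subsetI)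
    fix x assume x: "x \<in> {a..b}"
    obtain n :: nat where n: "max (k x) (inverse (k x)) < real n"
      using reals_Archimedean2 by blast
    then have "k x \<le> real (Suc n)" "inverse (k x) \<le> real (Suc n)" by auto
    then have "inverse (real (Suc n)) \<le> k x"
      using pos[OF x] by (metis inverse_inverse_eq le_imp_inverse_le positive_imp_inverse_positive)
    then show "x \<in> (\<Union>n. E n)"
      using x \<open>k x \<le> real (Suc n)\<close> by (auto simp: E_def)
  qed (auto simp: E_def)
  moreover have "incseq E"
  proof (intro incseq_SucI subsetI)
    fix n x assume "x \<in> E n"
    moreover have "inverse (real (Suc (Suc n))) \<le> inverse (real (Suc n))" "real (Suc n) \<le> real (Suc (Suc n))"
      by simp_all
    ultimately show "x \<in> E (Suc n)"
      unfolding E_def mem_Collect_eq atLeastAtMost_iff by linarith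
  qed
  moreover have "range E \<subseteq> sets lebesgue"
    using E_sets by blast
  ultimately have "(\<lambda>n. measure lebesgue (E n)) \<longlonglongrightarrow> measure lebesgue {a..b}"
    using Lim_measure_incseq[of E lebesgue] \<open>a < b\<close> by simp
  then have "(\<lambda>n. measure lebesgue (E n)) \<longlonglongrightarrow> b - a"
    using \<open>a < b\<close> by simp
  then have "eventually (\<lambda>n. measure lebesgue (E n) > 3/4 * (b - a)) sequentially"
    by (rule order_tendstoD) (use \<open>a < b\<close> in \<open>simp add: field_simps\<close>)
  then obtain n where n: "measure lebesgue (E n) > 3/4 * (b - a)"
    by (auto simp: eventually_sequentially)
  define N where "N = real (Suc n)"
  have N: "N > 0" by (simp add: N_def)
  \<comment> \<open>The factor for which the dilate of \<open>[a, b]\<close> ends at \<open>b + (b - a) / 4\<close>.\<close>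
  define q where "q = 1 + (b - a) / (4 * b)"
  have "q > 1" using assms by (simp add: q_def)
  moreover have "N^2 > 0" using N by simp
  moreover have "inverse (N^2) \<le> k l \<and> k l \<le> N^2"
    if l: "1 \<le> l" "l \<le> q"
      and mult: "\<And>x. x \<in> {a..b} \<Longrightarrow> l * x \<in> {a..b} \<Longrightarrow> k (l * x) = k l * k x" for l
  proof -
    let ?lE = "(\<lambda>x. l * x) ` E n"
    have m: "?lE \<in> lmeasurable \<and> l * measure lebesgue (E n) = measure lebesgue ?lE"
    proof (rule measure_linear_sufficient[OF _ E_lm])
      show "measure lebesgue ((*) l ` cbox u v) = l * measure lebesgue (cbox u v)" for u v
        using l measure_lebesgue_affine[of l 0 "cbox u v"] by simp
    qed (auto intro!: linearI simp: algebra_simps)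
    obtain y where "y \<in> E n" "y \<in> ?lE"
    proof (rule ccontr)
      assume "\<not> thesis"
      then have disj: "E n \<inter> ?lE = {}" using that by blast
      have sub: "E n \<union> ?lE \<subseteq> {a..b + (b - a) / 4}"
      proof
        fix y assume "y \<in> E n \<union> ?lE"
        then consider "y \<in> {a..b}" | x where "x \<in> {a..b}" "y = l * x"
          by (auto simp: E_def)
        then show "y \<in> {a..b + (b - a) / 4}"
        proof cases
          case 1
          moreover have "0 \<le> (b - a) / 4" using assms(2) by simp
          ultimately show ?thesis unfolding atLeastAtMost_iff by linarith
        next
          case 2
          have "1 * a \<le> l * x" using 2 l assms by (intro mult_mono) auto
          moreover have "l * x \<le> q * b" using 2 l assms by (intro mult_mono) auto
          moreover have "q * b = b + (b - a) / 4" using assms by (simp add: q_def field_simps)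
          ultimately show ?thesis using 2 by simp
        qed
      qed
      have "measure lebesgue (E n) \<le> l * measure lebesgue (E n)"
        using l mult_right_mono[of 1 l "measure lebesgue (E n)"] by simp
      moreover have "measure lebesgue (E n \<union> ?lE) = measure lebesgue (E n) + measure lebesgue ?lE"
        using measure_Un3[OF E_lm conjunct1[OF m]] disj by simp
      moreover have "measure lebesgue (E n \<union> ?lE) \<le> measure lebesgue {a..b + (b - a) / 4}"
        using sub fmeasurable.Un[OF E_lm conjunct1[OF m]]
        by (intro measure_mono_fmeasurable) (auto intro: fmeasurableD)
      moreover have "measure lebesgue {a..b + (b - a) / 4} = 5/4 * (b - a)"
        using assms(2) by (simp add: field_simps)
      ultimately show False using n conjunct2[OF m] assms(2) by argo
    qed
    then obtain x where x: "x \<in> E n" "l * x \<in> E n" by auto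
    then have kx: "inverse N \<le> k x" "k x \<le> N" "inverse N \<le> k (l * x)" "k (l * x) \<le> N"
      and ab: "x \<in> {a..b}" "l * x \<in> {a..b}"
      unfolding E_def N_def mem_Collect_eq atLeastAtMost_iff by blast+
    have "0 < inverse N" using N by simp
    then have kx0: "k x > 0" using kx(1) by linarith
    have kl: "k l = k (l * x) * inverse (k x)"
      using mult[OF ab] kx0 by simp
    have inv: "inverse N \<le> inverse (k x)" "inverse (k x) \<le> N"
      using le_imp_inverse_le[OF kx(2) kx0] le_imp_inverse_le[OF kx(1)] N by simp_all
    have "inverse N * inverse N \<le> k l" "k l \<le> N * N"
      unfolding kl using kx(3,4) inv N kx0 \<open>0 < inverse N\<close>
      by (auto intro!: mult_mono intro: order_trans[of 0 "inverse N"])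
    then show ?thesis by (simp add: power2_eq_square)
  qed
  ultimately show thesis by (rule that)
qed

text \<open>The function \<open>k\<close> is positive: near \<open>1\<close> it has the inverse \<open>k (1 / x)\<close>, multiplication carries
  nonvanishing down to \<open>0\<close>, and each value is a square. So its logarithm in the variable \<open>ln x\<close> solves
  Cauchy's equation on a half-line, and measurability makes the solution linear.\<close>

lemma measurable_multiplicative_powr:
  fixes R :: ereal and k :: "real \<Rightarrow> real"
  assumes "1 < R"
    and mult: "\<And>x y. \<lbrakk>0 < x; ereal x < R; 0 < y; ereal y < R; ereal (x * y) < R\<rbrakk> \<Longrightarrow> k (x * y) = k x * k y"
    and "k 1 = 1"
    and I: "0 < a" "a < b" "ereal b < R" "k \<in> borel_measurable (lebesgue_on {a..b})"
  obtains \<alpha> where "\<And>x. 0 < x \<Longrightarrow> ereal x < R \<Longrightarrow> k x = x powr \<alpha>"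
proof -
  obtain c :: real where c: "1 < c" "ereal c < R"
    using ereal_dense2[of 1 R] \<open>1 < R\<close> by (auto simp: one_ereal_def)
  have below: "ereal x < R" if "x \<le> y" "ereal y < R" for x y
    using that by (metis ereal_less_eq(3) le_less_trans)
  have unit: "ereal x < R" if "x \<le> 1" for x
    using below[of x c] that c by simp
  have inverse: "k x * k (1 / x) = 1" if "0 < x" "ereal x < R" "ereal (1 / x) < R" for x
    using mult[of x "1 / x"] that unit[of 1] \<open>k 1 = 1\<close> by simp
  \<comment> \<open>Each step to the left by the factor \<open>1 / c\<close> multiplies \<open>k\<close> by \<open>k (1 / c)\<close>, which is invertible
    because \<open>c\<close> still lies in the domain.\<close>
  have nonzero_pow: "k x \<noteq> 0" if "(1 / c) ^ n \<le> x" "x \<le> 1" for n x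
    using that
  proof (induction n arbitrary: x)
    case 0
    then show ?case using \<open>k 1 = 1\<close> by simp
  next
    case (Suc n)
    have "0 < x"
      using Suc.prems c by (meson divide_pos_pos less_le_trans order.strict_trans zero_less_one zero_less_power)
    show ?case
    proof (cases "1 / c \<le> x")
      case True
      then have "1 / x \<le> c" using c \<open>0 < x\<close> by (simp add: field_simps)
      then show ?thesis
        using inverse[of x] below[of "1 / x" c] unit[of x] \<open>0 < x\<close> Suc.prems c by auto
    next
      case False
      then have xc: "x * c \<le> 1" "(1 / c) ^ n \<le> x * c"
        using Suc.prems c by (simp_all add: field_simps)
      have "k (x * c * (1 / c)) = k (x * c) * k (1 / c)"
        using c \<open>0 < x\<close> xc Suc.prems unit by (intro mult) auto
      moreover have "k (1 / c) \<noteq> 0"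
        using inverse[of c] c unit[of "1 / c"] by auto
      ultimately show ?thesis using Suc.IH[OF xc(2,1)] c by simp
    qed
  qed
  have nonzero: "k x \<noteq> 0" if x: "0 < x" "ereal x < R" for x
  proof (cases "x \<le> 1")
    case True
    obtain n where "(1 / c) ^ n < x"
      using real_arch_pow_inv[of x "1 / c"] x c by auto
    then show ?thesis using nonzero_pow[of n x] True by simp
  next
    case False
    then show ?thesis using inverse[of x] x unit[of "1 / x"] by auto
  qed
  have pos: "k x > 0" if x: "0 < x" "ereal x < R" for x
  proof -
    have "sqrt x \<le> max x 1"
      using x real_sqrt_le_iff[of x "x * x"] by (cases "x \<le> 1") (auto simp: real_sqrt_mult max_def)
    then have "ereal (sqrt x) < R"
      using below[of "sqrt x" "max x 1"] x unit[of 1] by (auto simp: max_def split: if_splits)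
    then have "k x = k (sqrt x) * k (sqrt x)" "k (sqrt x) \<noteq> 0"
      using mult[of "sqrt x" "sqrt x"] nonzero[of "sqrt x"] x by auto
    then show ?thesis by (metis not_real_square_gt_zero)
  qed
  define g where "g t = ln (k (exp t))" for t
  define G where "G t = g (min t 0) - g (min (- t) 0)" for t
  have g_add: "g (s + t) = g s + g t" if "ereal (exp s) < R" "ereal (exp t) < R" "ereal (exp (s + t)) < R" for s t
    using that mult[of "exp s" "exp t"] pos[of "exp s"] pos[of "exp t"]
    by (simp add: g_def exp_add ln_mult)
  have "g 0 = 0" by (simp add: g_def \<open>k 1 = 1\<close>)
  have G_eq: "G t = g t" if "ereal (exp t) < R" for t
  proof (cases "t \<le> 0")
    case True
    then show ?thesis by (simp add: G_def \<open>g 0 = 0\<close>)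
  next
    case False
    then have "g t + g (- t) = 0"
      using g_add[of t "- t"] that unit[of "exp (- t)"] unit[of 1] \<open>g 0 = 0\<close> by simp
    then show ?thesis using False by (simp add: G_def \<open>g 0 = 0\<close>)
  qed
  have G_add: "G (s + t) = G s + G t" for s t
    unfolding G_def by (rule additive_on_halfline_extends, rule g_add) (auto intro: unit)
  have "k x > 0" if "x \<in> {a..b}" for x
    using pos[of x] that I below[of x b] by auto
  from measurable_multiplicative_locally_bounded[OF I(1,2,4) this]
  obtain q M where q: "q > 1" "M > 0"
    and bound: "\<And>l. 1 \<le> l \<Longrightarrow> l \<le> q \<Longrightarrow> (\<And>x. x \<in> {a..b} \<Longrightarrow> l * x \<in> {a..b} \<Longrightarrow> k (l * x) = k l * k x)
      \<Longrightarrow> inverse M \<le> k l \<and> k l \<le> M"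
    by blast
  have G_bound: "\<bar>G t\<bar> \<le> ln M" if t: "0 \<le> t" "t \<le> ln (min q c)" for t
  proof -
    have "exp t \<le> min q c"
      using t(2) q c by (subst (asm) ln_ge_iff) auto
    then have l: "1 \<le> exp t" "exp t \<le> q" "exp t \<le> c" using t by auto
    then have R: "ereal (exp t) < R" using below c by blast
    have "inverse M \<le> k (exp t) \<and> k (exp t) \<le> M"
    proof (rule bound[OF l(1,2)])
      fix x assume x: "x \<in> {a..b}" "exp t * x \<in> {a..b}"
      show "k (exp t * x) = k (exp t) * k x"
        using x I R by (intro mult) (auto intro: below[of _ b])
    qed
    then have "ln (inverse M) \<le> ln (k (exp t))" "ln (k (exp t)) \<le> ln M"
      using q pos[OF _ R] by simp_all
    then show ?thesis
      using G_eq[OF R] q by (simp add: g_def ln_inverse abs_le_iff)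
  qed
  have G_linear: "G t = G 1 * t" for t
    by (rule additive_bounded_near_0_linear[OF G_add _ G_bound]) (use q c in auto)
  have "k x = x powr (G 1)" if x: "0 < x" "ereal x < R" for x
  proof -
    have "ln (k x) = G 1 * ln x"
      using G_eq[of "ln x"] G_linear[of "ln x"] x by (simp add: g_def)
    moreover have "k x = exp (ln (k x))"
      using pos[OF x] by simp
    ultimately show ?thesis
      using x by (simp add: powr_def)
  qed
  then show thesis by (rule that)
qed

section \<open>Continuous characters of the line and the circle\<close>

lemma has_vector_derivative_translate:
  assumes "(f has_vector_derivative d) (at (x + a))"
  shows "((\<lambda>x. f (x + a)) has_vector_derivative d) (at x)"
proof -
  have "((\<lambda>x. x + a) has_vector_derivative 1) (at x)"
    by (auto intro!: derivative_eq_intros)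
  from vector_diff_chain_at[OF this assms] show ?thesis
    by (simp add: o_def)
qed

text \<open>Continuity upgrades itself to differentiability: with a primitive \<open>F\<close> of \<open>h\<close>, integrating
  \<open>h (t + s) = h t * h s\<close> in the variable \<open>s\<close> expresses \<open>h t\<close> through differences of \<open>F\<close>. Then \<open>h\<close> solves
  \<open>h' = c h\<close>, whose solutions are exponentials.\<close>

lemma continuous_character_exponential:
  fixes h :: "real \<Rightarrow> complex"
  assumes cont: "continuous_on UNIV h"
    and mult: "\<And>s t. h (s + t) = h s * h t" and "h 0 = 1"
  obtains c where "\<And>t. h t = exp (c * of_real t)"
proof -
  obtain F where F: "(F has_vector_derivative h x) (at x within {-3..3})" if "x \<in> {-3..3}" for x
    using antiderivative_continuous[OF continuous_on_subset[OF cont subset_UNIV]] by metis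
  have DF: "(F has_vector_derivative h x) (at x)" if "\<bar>x\<bar> < 3" for x
    using F[of x] that at_within_Icc_at[of "-3" x 3] by (simp add: abs_less_iff)
  have nonzero: "h t \<noteq> 0" for t
    using mult[of t "-t"] \<open>h 0 = 1\<close> by auto
  \<comment> \<open>Both sides vanish at \<open>s = 0\<close> and have the same derivative in \<open>s\<close>.\<close>
  have shift: "h t * (F s - F 0) = F (t + s) - F t" if "\<bar>t\<bar> < 1" "\<bar>s\<bar> < 1" for t s
  proof -
    have "((\<lambda>s. F (t + s) - h t * F s) has_derivative (\<lambda>_. 0)) (at x within {-1<..<1})"
      if "x \<in> {-1<..<1}" for x
    proof -
      have "\<bar>x + t\<bar> < 3" using that \<open>\<bar>t\<bar> < 1\<close> by auto
      then have "((\<lambda>s. F (t + s)) has_vector_derivative h (t + x)) (at x)"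
        using has_vector_derivative_translate[OF DF[of "x + t"]] by (simp add: add.commute)
      moreover have "((\<lambda>s. h t * F s) has_vector_derivative h t * h x) (at x)"
        using DF[of x] that by (intro derivative_intros) auto
      ultimately have "((\<lambda>s. F (t + s) - h t * F s) has_vector_derivative 0) (at x)"
        by (auto simp: mult dest: has_vector_derivative_diff)
      then show ?thesis
        by (auto simp: has_vector_derivative_def intro: has_derivative_at_withinI)
    qed
    then have "\<exists>c. \<forall>x\<in>{-1<..<1}. F (t + x) - h t * F x = c"
      by (intro has_derivative_zero_constant) auto
    then have "F (t + s) - h t * F s = F (t + 0) - h t * F 0"
      using that by (metis abs_less_iff abs_zero greaterThanLessThan_iff minus_less_iff zero_less_one)
    then show ?thesis by (simp add: algebra_simps)
  qed
  \<comment> \<open>A primitive that is constant near \<open>0\<close> would force \<open>h 0 = 0\<close>.\<close>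
  obtain a where a: "\<bar>a\<bar> < 1" "F a \<noteq> F 0"
  proof (rule ccontr)
    assume "\<not> thesis"
    then have const: "F x = F 0" if "\<bar>x\<bar> < 1" for x
      using that \<open>\<And>a. \<bar>a\<bar> < 1 \<Longrightarrow> F a \<noteq> F 0 \<Longrightarrow> thesis\<close> by blast
    have "((\<lambda>x. F 0) has_vector_derivative h 0) (at 0)"
    proof (rule has_vector_derivative_transform_within_open[where f = F and S = "{-1<..<1}"])
      show "F y = F 0" if "y \<in> {-1<..<1}" for y
        using that by (intro const) auto
    qed (use DF[of 0] in auto)
    then have "h 0 = 0"
      by (rule vector_derivative_unique_at[OF _ has_vector_derivative_const])
    then show False using nonzero by auto
  qed
  define c where "c = (h a - h 0) / (F a - F 0)"
  have D0: "(h has_vector_derivative c) (at 0)"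
  proof -
    have "((\<lambda>t. F (t + a)) has_vector_derivative h a) (at 0)"
      using DF[of a] a has_vector_derivative_translate[of F "h a" 0 a] by simp
    then have "((\<lambda>t. (F (t + a) - F t) / (F a - F 0)) has_vector_derivative c) (at 0)"
      unfolding c_def by (intro derivative_intros DF) auto
    then show ?thesis
      by (rule has_vector_derivative_transform_within_open[where f = "\<lambda>t. (F (t + a) - F t) / (F a - F 0)" and S = "{-1<..<1}"])
         (use a in \<open>auto simp: shift[symmetric]\<close>)
  qed
  have D: "(h has_vector_derivative h t * c) (at t)" for t
  proof -
    have "((\<lambda>x. h (x - t)) has_vector_derivative c) (at t)"
      using D0 has_vector_derivative_translate[of h c t "-t"] by simp
    then have "((\<lambda>x. h t * h (x - t)) has_vector_derivative h t * c) (at t)"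
      by (intro derivative_intros)
    then show ?thesis by (simp add: mult[symmetric])
  qed
  have "((\<lambda>t. h t * exp (- c * of_real t)) has_derivative (\<lambda>_. 0)) (at t within UNIV)" for t
  proof -
    have "((\<lambda>z. exp (- c * z)) has_field_derivative exp (- c * of_real t) * - c) (at (of_real t))"
      by (auto intro!: derivative_eq_intros)
    then have "((\<lambda>t. exp (- c * of_real t)) has_vector_derivative exp (- c * of_real t) * - c) (at t)"
      by (rule has_vector_derivative_real_field)
    from has_vector_derivative_mult[OF D this]
    show ?thesis by (simp add: has_vector_derivative_def algebra_simps)
  qed
  then have "\<exists>d. \<forall>t\<in>UNIV. h t * exp (- c * of_real t) = d"
    by (intro has_derivative_zero_constant) auto
  then have "h t * exp (- c * of_real t) = 1" for t
    using \<open>h 0 = 1\<close> by (metis UNIV_I exp_zero mult.right_neutral mult_zero_right of_real_0)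
  then have "h t = exp (c * of_real t)" for t
    by (simp add: exp_minus field_simps)
  then show thesis using that by blast
qed

text \<open>Pulled back along the covering \<open>cis\<close>, the character becomes an exponential of \<open>\<real>\<close>, and the period
  \<open>2 \<pi>\<close> forces an integral frequency.\<close>

lemma continuous_character_circle:
  fixes K :: "complex \<Rightarrow> complex"
  assumes cont: "continuous_on (sphere 0 1) K"
    and mult: "\<And>z w. \<lbrakk>z \<in> sphere 0 1; w \<in> sphere 0 1\<rbrakk> \<Longrightarrow> K (z * w) = K z * K w"
    and "K 1 = 1"
  obtains \<beta> :: int where "\<And>t. K (cis t) = exp (\<i> * of_int \<beta> * of_real t)"
proof -
  have cont': "continuous_on UNIV (\<lambda>t. K (cis t))"
    by (rule continuous_on_compose2[OF cont]) (auto intro!: continuous_intros)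
  have mult': "K (cis (s + t)) = K (cis s) * K (cis t)" for s t
    using mult[of "cis s" "cis t"] by (simp add: cis_mult)
  obtain c where c: "\<And>t. K (cis t) = exp (c * of_real t)"
    using continuous_character_exponential[OF cont' mult'] \<open>K 1 = 1\<close> by auto
  have "exp (c * of_real (2 * pi)) = 1"
    using c[of "2 * pi"] \<open>K 1 = 1\<close> by simp
  then obtain n :: int where "Re c * (2 * pi) = 0" "Im c * (2 * pi) = of_int (2 * n) * pi"
    by (auto simp: exp_eq_1)
  then have "c = \<i> * of_int n"
    by (simp add: complex_eq_iff)
  with c have "K (cis t) = exp (\<i> * of_int n * of_real t)" for t
    by simp
  then show thesis by (rule that)
qed

section \<open>The classification\<close>

text \<open>In polar coordinates \<open>K z = K \<bar>z\<bar> * K (z / \<bar>z\<bar>)\<close>, for \<open>z \<noteq> 0\<close>, where both arguments lie in the disc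
  because \<open>R > 1\<close>.\<close>

lemma multiplicative_imp_Psi:
  fixes R :: ereal and K :: "complex \<Rightarrow> complex"
  assumes "1 < R"
    and mult: "multiplicative_on (eball 0 R) K"
    and cont: "continuous_on (sphere 0 1) K"
    and real: "\<And>x. 0 < x \<Longrightarrow> ereal x < R \<Longrightarrow> K (of_real x) \<in> \<real>"
    and I: "is_interval I" "a \<in> I" "b \<in> I" "a < b" "I \<subseteq> {x. 0 < x \<and> ereal x < R}"
      "(\<lambda>x. K (of_real x)) \<in> borel_measurable (lebesgue_on I)"
    and "K 0 = 0" "K 1 = 1"
  shows "\<exists>\<alpha> \<beta>. \<forall>z\<in>eball 0 R. K z = Psi \<alpha> \<beta> z"
proof -
  have K_mult: "K (z * w) = K z * K w"
    if "ereal (cmod z) < R" "ereal (cmod w) < R" "ereal (cmod (z * w)) < R" for z w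
    using mult that by (simp add: multiplicative_on_def)
  have circle: "ereal (cmod z) < R" if "cmod z = 1" for z
    using that \<open>1 < R\<close> by (simp add: one_ereal_def)
  define k where "k x = Re (K (of_real x))" for x
  have k: "K (of_real x) = of_real (k x)" if "0 < x" "ereal x < R" for x
    using real[OF that] by (simp add: k_def)
  have ab: "{a..b} \<subseteq> I"
  proof
    fix x assume "x \<in> {a..b}"
    then show "x \<in> I"
      using mem_is_interval_1_I[OF I(1-3), of x] by simp
  qed
  have "a \<in> {x. 0 < x \<and> ereal x < R}" "b \<in> {x. 0 < x \<and> ereal x < R}"
    using I(2,3,5) by blast+
  then have bounds: "0 < a" "ereal b < R"
    by simp_all
  have "(\<lambda>x. K (of_real x)) \<in> borel_measurable (lebesgue_on {a..b})"
    using measurable_restrict_mono[OF I(6) ab] .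
  then have meas: "k \<in> borel_measurable (lebesgue_on {a..b})"
    unfolding k_def by simp
  have k_mult: "k (x * y) = k x * k y"
    if "0 < x" "ereal x < R" "0 < y" "ereal y < R" "ereal (x * y) < R" for x y
  proof -
    have "of_real (k (x * y)) = (of_real (k x * k y) :: complex)"
      using K_mult[of "of_real x" "of_real y"] that k[of x] k[of y] k[of "x * y"]
      by (simp add: norm_mult)
    then show ?thesis by (rule of_real_eq_iff[THEN iffD1])
  qed
  have "k 1 = 1" by (simp add: k_def \<open>K 1 = 1\<close>)
  obtain \<alpha> where \<alpha>: "\<And>x. 0 < x \<Longrightarrow> ereal x < R \<Longrightarrow> k x = x powr \<alpha>"
    using measurable_multiplicative_powr[OF \<open>1 < R\<close> k_mult \<open>k 1 = 1\<close> bounds(1) I(4) bounds(2) meas] by blast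
  have circle_mult: "K (z * w) = K z * K w" if "z \<in> sphere 0 1" "w \<in> sphere 0 1" for z w
    using that circle[of z] circle[of w] circle[of "z * w"] by (intro K_mult) (simp_all add: norm_mult)
  obtain \<beta> where \<beta>: "\<And>t. K (cis t) = exp (\<i> * of_int \<beta> * of_real t)"
    using continuous_character_circle[OF cont circle_mult \<open>K 1 = 1\<close>] by blast
  have "K z = Psi \<alpha> \<beta> z" if z: "ereal (cmod z) < R" for z
  proof (cases "z = 0")
    case True
    then show ?thesis by (simp add: \<open>K 0 = 0\<close>)
  next
    case False
    have polar: "of_real (cmod z) * cis (Arg z) = z"
      using rcis_cmod_Arg[of z] by (simp add: rcis_def)
    have "K (of_real (cmod z) * cis (Arg z)) = K (of_real (cmod z)) * K (cis (Arg z))"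
      using z circle[of "cis (Arg z)"] by (intro K_mult) (simp_all add: norm_mult)
    then show ?thesis
      using False z k[of "cmod z"] \<alpha>[of "cmod z"] \<beta>[of "Arg z"] by (simp add: polar Psi_def)
  qed
  then show ?thesis by auto
qed

theorem lemma3p1:
  fixes R :: ereal and K :: "complex \<Rightarrow> complex"
  assumes "1 < R"
  shows
    "((multiplicative_on (eball 0 R) K
       \<and> continuous_on (sphere 0 1) K
       \<and> (\<forall>x::real. 0 < x \<and> ereal x < R \<longrightarrow> K (of_real x) \<in> \<real>)
       \<and> (\<exists>I::real set. is_interval I \<and> (\<exists>a\<in>I. \<exists>b\<in>I. a < b)
            \<and> I \<subseteq> {x. 0 < x \<and> ereal x < R} \<and> 1 \<in> I
            \<and> (\<lambda>x. K (of_real x)) \<in> borel_measurable (lebesgue_on I)))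
      \<longleftrightarrow>
      ((\<forall>z\<in>eball 0 R. K z = 0)
       \<or> (\<forall>z\<in>eball 0 R. K z = 1)
       \<or> (\<exists>\<alpha> \<beta>. \<forall>z\<in>eball 0 R. K z = Psi \<alpha> \<beta> z)))
     \<and> (\<forall>r::ereal. 0 < r \<longrightarrow>
          lin_independent_on (eball 0 r) ({Psi \<alpha> \<beta> | \<alpha> \<beta>. True} \<union> {\<lambda>z. 1}))"
    (is "(?analytic \<longleftrightarrow> ?classified) \<and> ?independent")
proof (rule conjI[OF iffI])
  have in_D: "0 \<in> eball (0::complex) R" "1 \<in> eball (0::complex) R"
    using \<open>1 < R\<close> order.strict_trans[of 0 1 R] by (auto simp: zero_ereal_def one_ereal_def)
  show ?classified if ?analytic
  proof -
    have mult: "K (z * w) = K z * K w" if "z \<in> eball 0 R" "w \<in> eball 0 R" "z * w \<in> eball 0 R" for z w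
      using \<open>?analytic\<close> that by (simp add: multiplicative_on_def)
    \<comment> \<open>\<open>K 0\<close> and \<open>K 1\<close> are idempotent; the degenerate values give the two constant functions.\<close>
    consider "K 0 \<noteq> 0" | "K 1 = 0" | "K 0 = 0" "K 1 = 1"
      using mult[of 1 1] in_D by auto
    then show ?thesis
    proof cases
      case 1
      have "K z = 1" if "z \<in> eball 0 R" for z
        using mult[OF in_D(1) that] in_D 1 by simp
      then show ?thesis by blast
    next
      case 2
      have "K z = 0" if "z \<in> eball 0 R" for z
        using mult[OF in_D(2) that] that 2 by simp
      then show ?thesis by blast
    next
      case 3
      from that obtain I a b where "is_interval I" "a \<in> I" "b \<in> I" "a < b"
        "I \<subseteq> {x. 0 < x \<and> ereal x < R}" "(\<lambda>x. K (of_real x)) \<in> borel_measurable (lebesgue_on I)"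
        by blast
      then have "\<exists>\<alpha> \<beta>. \<forall>z\<in>eball 0 R. K z = Psi \<alpha> \<beta> z"
        using that 3 by (intro multiplicative_imp_Psi[OF \<open>1 < R\<close>]) auto
      then show ?thesis by blast
    qed
  qed
  show ?analytic if ?classified
  proof -
    \<comment> \<open>\<open>L\<close> is the closed form on the whole plane, while \<open>K\<close> is arbitrary outside the disc.\<close>
    from that obtain L where K: "\<And>z. z \<in> eball 0 R \<Longrightarrow> K z = L z"
      and L: "L = (\<lambda>z. 0) \<or> L = (\<lambda>z. 1) \<or> (\<exists>\<alpha> \<beta>. L = Psi \<alpha> \<beta>)"
      by metis
    have "L (z * w) = L z * L w" for z w
      using L by (auto simp: Psi_mult)
    then have K_mult: "multiplicative_on (eball 0 R) K"
      using K by (simp add: multiplicative_on_def)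
    have "continuous_on (sphere 0 1) L"
      using L Psi_continuous_on_circle by auto
    then have K_cont: "continuous_on (sphere 0 1) K"
      by (rule continuous_on_eq) (use K \<open>1 < R\<close> in \<open>auto simp: one_ereal_def\<close>)
    have L_real: "L (of_real x) \<in> \<real>" if "0 < x" for x
      using L Psi_of_real[OF that] by auto
    have K_real: "K (of_real x) \<in> \<real>" if "0 < x" "ereal x < R" for x
      using K[of "of_real x"] L_real[of x] that by simp
    have half: "{1/2..1} \<subseteq> {x. 0 < x \<and> ereal x < R}"
      using \<open>1 < R\<close> by (auto simp: one_ereal_def intro: le_less_trans[of _ "ereal 1"])
    have "(\<lambda>x. K (of_real x)) \<in> borel_measurable (lebesgue_on {1/2..1})"
    proof (rule continuous_imp_measurable_on_sets_lebesgue)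
      have "continuous_on {1/2..1} (\<lambda>x::real. complex_of_real (x powr \<alpha>))" for \<alpha>
        by (intro continuous_intros) auto
      then have "continuous_on {1/2..1} (\<lambda>x::real. Psi \<alpha> \<beta> (of_real x))" for \<alpha> \<beta>
        by (rule continuous_on_eq) (simp add: Psi_of_real)
      then have "continuous_on {1/2..1} (\<lambda>x::real. L (of_real x))"
        using L by auto
      then show "continuous_on {1/2..1} (\<lambda>x::real. K (of_real x))"
        by (rule continuous_on_eq) (use K half in auto)
    qed auto
    moreover have "\<exists>a\<in>{1/2..1::real}. \<exists>b\<in>{1/2..1}. a < b"
      by (intro bexI[of _ "1/2"] bexI[of _ 1]) auto
    ultimately have "\<exists>I::real set. is_interval I \<and> (\<exists>a\<in>I. \<exists>b\<in>I. a < b)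
        \<and> I \<subseteq> {x. 0 < x \<and> ereal x < R} \<and> 1 \<in> I
        \<and> (\<lambda>x. K (of_real x)) \<in> borel_measurable (lebesgue_on I)"
      using half by (intro exI[of _ "{1/2..1}"]) (simp add: is_interval_cc)
    with K_mult K_cont K_real show ?thesis by blast
  qed
  show ?independent
    using Psi_family_independent by blast
qed

end
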